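(* Let $A$ be an $n\times n$ max-plus matrix with $\mathrm{per}(A)\neq-\infty$. Then the closures of all definite forms of $A$ coincide: if $\sigma$ and $\rho$ are maximal permutations of $A$, and $A'$ and $A''$ are the definite forms of $A$ corresponding to $\sigma$ and $\rho$ respectively, then $(A')^*=(A'')^*$.
   Context: All arithmetic is written conventionally on $\mathbb{R}_{\max}=\mathbb{R}\cup\{-\infty\}$, the semiring with addition $\oplus=\max$ and multiplication $\odot=+$ (with $\alpha+(-\infty)=-\infty$); its zero is $-\infty$ and its unity is the real number $0$. A max-plus matrix is a matrix with entries in $\mathbb{R}_{\max}$; products are $(A\odot B)_{ij}=\max_k (A_{ik}+B_{kj})$, sums are entrywise maxima, and $I$ is the max-plus identity matrix ($0$ on the diagonal, $-\infty$ elsewhere). The weight of a permutation $\sigma$ of $\{1,\dots,n\}$ is $\sum_{i=1}^n A_{i\sigma(i)}$, and the permanent is $\mathrm{per}(A)=\max_{\sigma\in S_n}\sum_{i=1}^n A_{i\sigma(i)}$. A maximal permutation is one whose weight equals $\mathrm{per}(A)$. If $\mathrm{per}(A)\ne-\infty$ and $\sigma$ is a maximal permutation of $A$, the definite form of $A$ corresponding to $\sigma$ is the matrix $A'$ with entries $A'_{ij}=A_{i\sigma(j)}-A_{j\sigma(j)}$. It has zero diagonal and all its cycle means (averages $\frac{1}{|K|}\sum_{i\in K}A'_{i\tau(i)}$ over cyclic permutations $\tau$ of nonempty subsets $K\subseteq\{1,\dots,n\}$) are at most $0$. Closure: $M^*=I\oplus M\oplus M^2\oplus\cdots$ (entrywise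 supremum of max-plus powers); it exists whenever all cycle means of $M$ are at most $0$, in particular for definite forms. *)

theory Defs
  imports "HOL-Analysis.Analysis"
begin

text \<open>
  The max-plus semiring is the set of extended reals other than \<open>\<infinity>\<close>, with \<open>\<oplus> = max\<close> and
  \<open>\<odot> = +\<close>. On this set the addition of \<^typ>\<open>ereal\<close> satisfies \<open>a + (-\<infinity>) = -\<infinity>\<close>; the exclusion
  of \<open>\<infinity>\<close> matters, since \<open>\<infinity> + (-\<infinity>) = \<infinity>\<close> in \<^typ>\<open>ereal\<close>. An \<open>n \<times> n\<close> matrix is indexed by a
  finite type with \<open>n\<close> elements.
\<close>

definition Rmax :: "ereal set" where
  "Rmax = {x. x \<noteq> \<infinity>}"

definition maxplus_matrix :: "ereal^'n^'n \<Rightarrow> bool" where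
  "maxplus_matrix A \<longleftrightarrow> (\<forall>i j. A $ i $ j \<in> Rmax)"

definition mp_mult :: "ereal^'n^'n \<Rightarrow> ereal^'n^'n \<Rightarrow> ereal^'n^'n" where
  "mp_mult A B = (\<chi> i j. MAX k. A $ i $ k + B $ k $ j)"

definition mp_one :: "ereal^'n^'n" where
  "mp_one = (\<chi> i j. if i = j then 0 else -\<infinity>)"

primrec mp_power :: "ereal^'n^'n \<Rightarrow> nat \<Rightarrow> ereal^'n^'n" where
  "mp_power M 0 = mp_one"
| "mp_power M (Suc k) = mp_mult M (mp_power M k)"

text \<open>
  The supremum is taken in \<^typ>\<open>ereal\<close>, so it always exists; it agrees with the supremum in \<open>Rmax\<close>
  whenever the latter exists, in particular when all cycle means of \<open>M\<close> are at most \<open>0\<close>.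
\<close>

definition mp_closure :: "ereal^'n^'n \<Rightarrow> ereal^'n^'n" where
  "mp_closure M = (\<chi> i j. SUP k. mp_power M k $ i $ j)"

definition perm_weight :: "ereal^'n^'n \<Rightarrow> ('n \<Rightarrow> 'n) \<Rightarrow> ereal" where
  "perm_weight A \<sigma> = (\<Sum>i\<in>UNIV. A $ i $ \<sigma> i)"

definition mp_permanent :: "ereal^'n^'n \<Rightarrow> ereal" where
  "mp_permanent A = Max (perm_weight A ` {\<sigma>. \<sigma> permutes UNIV})"

definition maximal_permutation :: "ereal^'n^'n \<Rightarrow> ('n \<Rightarrow> 'n) \<Rightarrow> bool" where
  "maximal_permutation A \<sigma> \<longleftrightarrow> \<sigma> permutes UNIV \<and> perm_weight A \<sigma> = mp_permanent A"

definition definite_form :: "ereal^'n^'n \<Rightarrow> ('n \<Rightarrow> 'n) \<Rightarrow> ereal^'n^'n" where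
  "definite_form A \<sigma> = (\<chi> i j. A $ i $ \<sigma> j - A $ j $ \<sigma> j)"

end

theory Submission
  imports Defs "HOL-Combinatorics.Orbits"
begin

text \<open>
  It suffices to bound every entry of \<open>A''\<close> by an entry of a power of \<open>A'\<close>, since the closure of \<open>A'\<close>
  is idempotent. With \<open>\<pi> = \<sigma>\<inverse> \<circ> \<rho>\<close> one has \<open>A''\<^sub>i\<^sub>j = A'\<^sub>i\<^sub>p - A'\<^sub>j\<^sub>p\<close> where \<open>p = \<pi> j\<close>. Let \<open>C\<close> be the
  cycle of \<open>\<pi>\<close> through \<open>j\<close>. Replacing \<open>\<rho>\<close> by \<open>\<sigma>\<close> on \<open>C\<close> yields again a permutation, so the maximality
  of \<open>\<rho>\<close> shows that \<open>C\<close> has nonnegative weight in \<open>A'\<close>. Hence \<open>-A'\<^sub>j\<^sub>p\<close> is at most the weight of the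
  walk that follows \<open>C\<close> from \<open>p\<close> back to \<open>j\<close>, and \<open>A''\<^sub>i\<^sub>j\<close> is at most the weight of a walk from \<open>i\<close>
  to \<open>j\<close> in \<open>A'\<close>.
\<close>

lemma mp_mult_ge: "A $ i $ k + B $ k $ j \<le> mp_mult A B $ i $ j"
  by (auto simp: mp_mult_def intro!: Max_ge)

lemma mp_mult_attained:
  obtains k where "mp_mult A B $ i $ j = A $ i $ k + B $ k $ j"
proof -
  have "Max (range (\<lambda>k. A $ i $ k + B $ k $ j)) \<in> range (\<lambda>k. A $ i $ k + B $ k $ j)"
    by (intro Max_in) auto
  then obtain k where "Max (range (\<lambda>k. A $ i $ k + B $ k $ j)) = A $ i $ k + B $ k $ j"
    by blast
  then show ?thesis using that[of k] by (simp add: mp_mult_def)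
qed

lemma maxplus_matrix_power:
  assumes "maxplus_matrix M"
  shows "maxplus_matrix (mp_power M k)"
proof (induction k)
  case 0
  then show ?case by (auto simp: maxplus_matrix_def Rmax_def mp_one_def)
next
  case (Suc k)
  have "mp_mult M (mp_power M k) $ i $ j \<noteq> \<infinity>" for i j
    by (rule mp_mult_attained[of M "mp_power M k" i j])
      (use Suc assms in \<open>auto simp: maxplus_matrix_def Rmax_def\<close>)
  then show ?case by (simp add: maxplus_matrix_def Rmax_def)
qed

text \<open>A heaviest walk of \<open>k\<close> steps from \<open>i\<close> to \<open>l\<close>,
  continued by one of \<open>m\<close> steps from \<open>l\<close> to \<open>j\<close>, is one
  candidate among the walks of \<open>k + m\<close> steps.\<close>

lemma mp_power_add_ge:
  assumes M: "maxplus_matrix M"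
  shows "mp_power M k $ i $ l + mp_power M m $ l $ j \<le> mp_power M (k + m) $ i $ j"
proof (induction k arbitrary: i)
  case 0
  \<comment> \<open>For \<open>i \<noteq> l\<close> the first summand is
    \<open>-\<infinity>\<close>, which in \<open>ereal\<close> absorbs the second one only if that
    is not \<open>\<infinity>\<close>.\<close>
  have "mp_power M m $ l $ j \<noteq> \<infinity>"
    using maxplus_matrix_power[OF M] by (simp add: maxplus_matrix_def Rmax_def)
  then show ?case by (cases "mp_power M m $ l $ j") (auto simp: mp_one_def)
next
  case (Suc k)
  obtain h where h: "mp_power M (Suc k) $ i $ l = M $ i $ h + mp_power M k $ h $ l"
    using mp_mult_attained[of M "mp_power M k" i l] by auto
  have "mp_power M (Suc k) $ i $ l + mp_power M m $ l $ j
      = M $ i $ h + (mp_power M k $ h $ l + mp_power M m $ l $ j)"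
    by (simp only: h add.assoc)
  also have "\<dots> \<le> M $ i $ h + mp_power M (k + m) $ h $ j"
    by (intro add_left_mono Suc.IH)
  also have "\<dots> \<le> mp_power M (Suc k + m) $ i $ j"
    by (simp add: mp_mult_ge)
  finally show ?case .
qed

text \<open>Each edge of a walk in \<open>N\<close> can be replaced by a walk in \<open>M\<close>
  that weighs at least as much. The length \<open>m\<close> may differ from edge to edge, as the
  closure ranges over all lengths.\<close>

lemma mp_closure_le:
  assumes M: "maxplus_matrix M"
    and le: "\<And>i j. \<exists>m. N $ i $ j \<le> mp_power M m $ i $ j"
  shows "mp_closure N $ i $ j \<le> mp_closure M $ i $ j"
proof -
  have "\<exists>m. mp_power N k $ i $ j \<le> mp_power M m $ i $ j" for k i
  proof (induction k arbitrary: i)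
    case 0
    show ?case by (intro exI[of _ 0]) simp
  next
    case (Suc k)
    obtain h where h: "mp_power N (Suc k) $ i $ j = N $ i $ h + mp_power N k $ h $ j"
      using mp_mult_attained[of N "mp_power N k" i j] by auto
    obtain m m' where "N $ i $ h \<le> mp_power M m $ i $ h"
      "mp_power N k $ h $ j \<le> mp_power M m' $ h $ j"
      using le Suc.IH by blast
    then have "mp_power N (Suc k) $ i $ j \<le> mp_power M m $ i $ h + mp_power M m' $ h $ j"
      unfolding h by (rule add_mono)
    also have "\<dots> \<le> mp_power M (m + m') $ i $ j"
      by (rule mp_power_add_ge[OF M])
    finally show ?case by blast
  qed
  then show ?thesis
    by (auto simp: mp_closure_def intro!: SUP_mono)
qed

text \<open>Iterating \<open>f\<close> from \<open>x\<close> traces one particular walk of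
  \<open>k\<close> steps. The bound \<open>w\<close> is real so that weights of cycles can be
  rearranged and subtracted.\<close>

lemma mp_power_funpow_ge:
  assumes "\<And>x. ereal (w x) \<le> M $ x $ f x"
  shows "ereal (\<Sum>t<k. w ((f ^^ t) x)) \<le> mp_power M k $ x $ (f ^^ k) x"
proof (induction k arbitrary: x)
  case 0
  then show ?case by (simp add: mp_one_def zero_ereal_def)
next
  case (Suc k)
  have "ereal (\<Sum>t<Suc k. w ((f ^^ t) x)) = ereal (w x) + ereal (\<Sum>t<k. w ((f ^^ t) (f x)))"
    by (simp add: sum.lessThan_Suc_shift funpow_swap1 del: sum.lessThan_Suc)
  also have "\<dots> \<le> M $ x $ f x + mp_power M k $ f x $ (f ^^ k) (f x)"
    by (intro add_mono assms Suc.IH)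
  also have "\<dots> \<le> mp_power M (Suc k) $ x $ (f ^^ Suc k) x"
    by (simp add: mp_mult_ge funpow_swap1)
  finally show ?case .
qed

text \<open>As no entry is \<open>\<infinity>\<close>, a single summand \<open>-\<infinity>\<close>
  would pull the whole weight, hence the permanent, down to \<open>-\<infinity>\<close>.\<close>

lemma maximal_permutation_entry_finite:
  assumes "maxplus_matrix A" "mp_permanent A \<noteq> -\<infinity>" "maximal_permutation A \<sigma>"
  shows "A $ x $ \<sigma> x = ereal (real_of_ereal (A $ x $ \<sigma> x))"
proof -
  have ne: "A $ y $ \<sigma> y \<noteq> \<infinity>" for y
    using assms(1) by (simp add: maxplus_matrix_def Rmax_def)
  have "(\<Sum>y\<in>UNIV - {x}. A $ y $ \<sigma> y) \<noteq> \<infinity>"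
    by (simp add: sum_Pinfty ne)
  moreover have "perm_weight A \<sigma> = A $ x $ \<sigma> x + (\<Sum>y\<in>UNIV - {x}. A $ y $ \<sigma> y)"
    unfolding perm_weight_def by (rule sum.remove) auto
  ultimately have "A $ x $ \<sigma> x \<noteq> -\<infinity>"
    using assms(2,3)
    by (cases "\<Sum>y\<in>UNIV - {x}. A $ y $ \<sigma> y") (auto simp: maximal_permutation_def)
  with ne[of x] show ?thesis by (cases "A $ x $ \<sigma> x") auto
qed

text \<open>Since \<open>\<sigma>\<close> and \<open>\<rho>\<close> have the same image on
  \<open>C\<close>, the image of \<open>\<sigma>\<close> on \<open>C\<close> and that of
  \<open>\<rho>\<close> on the complement partition the whole type.\<close>

lemma permutes_exchange:
  assumes \<sigma>: "\<sigma> permutes UNIV" and \<rho>: "\<rho> permutes UNIV" and img: "\<sigma> ` C = \<rho> ` C"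
  shows "(\<lambda>x. if x \<in> C then \<sigma> x else \<rho> x) permutes UNIV"
proof -
  have "bij_betw (\<lambda>x. if x \<in> C then \<sigma> x else \<rho> x) (C \<union> - C) (\<rho> ` C \<union> - (\<rho> ` C))"
  proof (rule bij_betw_disjoint_Un)
    show "bij_betw \<sigma> C (\<rho> ` C)"
      using \<sigma> img by (metis permutes_inj_on inj_on_imp_bij_betw)
    have "\<rho> ` (- C) = - (\<rho> ` C)"
      using \<rho> by (simp add: bij_image_Compl_eq permutes_bij)
    then show "bij_betw \<rho> (- C) (- (\<rho> ` C))"
      using \<rho> by (metis permutes_inj_on inj_on_imp_bij_betw)
  qed auto
  then show ?thesis
    by (auto intro: bij_imp_permutes)
qed

text \<open>The exchanged permutation weighs no more than \<open>\<rho>\<close>, and the terms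
  outside \<open>C\<close>, being real, cancel. Maximality of \<open>\<sigma>\<close> makes its
  entries real too.\<close>

lemma maximal_permutation_exchange:
  assumes A: "maxplus_matrix A" "mp_permanent A \<noteq> -\<infinity>"
    and \<sigma>: "maximal_permutation A \<sigma>" and \<rho>: "maximal_permutation A \<rho>"
    and img: "\<sigma> ` C = \<rho> ` C"
  shows "(\<Sum>x\<in>C. real_of_ereal (A $ x $ \<sigma> x)) \<le> (\<Sum>x\<in>C. real_of_ereal (A $ x $ \<rho> x))"
proof -
  define \<tau> where "\<tau> = (\<lambda>x. if x \<in> C then \<sigma> x else \<rho> x)"
  define s where "s x = real_of_ereal (A $ x $ \<sigma> x)" for x
  define r where "r x = real_of_ereal (A $ x $ \<rho> x)" for x
  have s: "A $ x $ \<sigma> x = ereal (s x)" and r: "A $ x $ \<rho> x = ereal (r x)" for x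
    unfolding s_def r_def by (intro maximal_permutation_entry_finite[OF A] \<sigma> \<rho>)+
  have "perm_weight A \<tau> \<le> mp_permanent A"
    using permutes_exchange[OF _ _ img] \<sigma> \<rho>
    by (auto simp: mp_permanent_def maximal_permutation_def \<tau>_def intro!: Max_ge)
  also have "\<dots> = perm_weight A \<rho>"
    using \<rho> by (simp add: maximal_permutation_def)
  also have "\<dots> = ereal (\<Sum>x\<in>UNIV. r x)"
    by (simp add: perm_weight_def r)
  also have "perm_weight A \<tau> = (\<Sum>x\<in>UNIV. ereal (if x \<in> C then s x else r x))"
    unfolding perm_weight_def by (intro sum.cong) (auto simp: \<tau>_def s r)
  finally have "(\<Sum>x\<in>UNIV. if x \<in> C then s x else r x) \<le> (\<Sum>x\<in>UNIV. r x)"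
    by simp
  moreover have "(\<Sum>x\<in>UNIV. if x \<in> C then s x else r x) = sum s C + sum r (- C)"
    by (simp add: sum.If_cases)
  moreover have "sum r UNIV = sum r C + sum r (- C)"
    by (metis Compl_eq_Diff_UNIV add.commute finite subset_UNIV sum.subset_diff)
  ultimately show ?thesis
    by (simp add: s_def r_def)
qed

text \<open>Only subtracting \<open>-\<infinity>\<close> could produce \<open>\<infinity>\<close>,
  and the subtracted entries are real.\<close>

lemma maxplus_matrix_definite_form:
  assumes "maxplus_matrix A" "mp_permanent A \<noteq> -\<infinity>" "maximal_permutation A \<sigma>"
  shows "maxplus_matrix (definite_form A \<sigma>)"
proof -
  have "A $ i $ \<sigma> j - A $ j $ \<sigma> j \<noteq> \<infinity>" for i j
    using assms(1) maximal_permutation_entry_finite[OF assms, of j]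
    by (cases "A $ i $ \<sigma> j"; cases "A $ j $ \<sigma> j") (auto simp: maxplus_matrix_def Rmax_def)
  then show ?thesis
    by (simp add: maxplus_matrix_def Rmax_def definite_form_def)
qed

lemma definite_form_le_power:
  assumes A: "maxplus_matrix A" "mp_permanent A \<noteq> -\<infinity>"
    and \<sigma>: "maximal_permutation A \<sigma>" and \<rho>: "maximal_permutation A \<rho>"
  shows "\<exists>m. definite_form A \<rho> $ i $ j \<le> mp_power (definite_form A \<sigma>) m $ i $ j"
proof -
  let ?M = "definite_form A \<sigma>"
  define s where "s x = real_of_ereal (A $ x $ \<sigma> x)" for x
  define r where "r x = real_of_ereal (A $ x $ \<rho> x)" for x
  have s: "A $ x $ \<sigma> x = ereal (s x)" and r: "A $ x $ \<rho> x = ereal (r x)" for x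
    unfolding s_def r_def by (intro maximal_permutation_entry_finite[OF A] \<sigma> \<rho>)+
  have perm: "\<sigma> permutes UNIV" "\<rho> permutes UNIV"
    using \<sigma> \<rho> by (auto simp: maximal_permutation_def)
  define \<pi> where "\<pi> = inv \<sigma> \<circ> \<rho>"
  have \<sigma>\<pi>: "\<sigma> (\<pi> x) = \<rho> x" for x
    using perm by (simp add: \<pi>_def permutes_inverses)
  have \<pi>: "\<pi> permutes UNIV"
    unfolding \<pi>_def using perm by (intro permutes_compose permutes_inv)
  \<comment> \<open>The weight of the edge from \<open>x\<close> to \<open>\<pi> x\<close> in
    \<open>?M\<close>.\<close>
  define w where "w x = r x - s (\<pi> x)" for x
  have w: "?M $ x $ \<pi> x = ereal (w x)" for x
    by (simp add: definite_form_def \<sigma>\<pi> s r w_def)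
  define C where "C = orbit \<pi> j"
  have j: "j \<in> orbit \<pi> j"
    using \<pi> by (intro permutation_self_in_orbit) (auto simp: permutation_permutes)
  \<comment> \<open>An injective map of a finite set into itself is onto.\<close>
  have \<pi>C: "\<pi> ` C = C"
    unfolding C_def using finite_orbit[OF j] permutes_inj_on[OF \<pi>]
    by (intro endo_inj_surj) (auto intro: orbit.step)
  have "\<sigma> ` C = \<rho> ` C"
    by (metis (no_types, lifting) \<pi>C \<sigma>\<pi> image_cong image_image)
  then have "sum s C \<le> sum r C"
    unfolding s_def r_def by (rule maximal_permutation_exchange[OF A \<sigma> \<rho>])
  \<comment> \<open>Reindexing by \<open>\<pi>\<close> turns the weight of the cycle into
    \<open>sum r C - sum s C\<close>.\<close>
  moreover have "(\<Sum>x\<in>C. s (\<pi> x)) = sum s C"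
    using sum.reindex[of \<pi> C s] \<pi>C permutes_inj_on[OF \<pi>] by simp
  ultimately have cycle: "0 \<le> sum w C"
    by (simp add: w_def sum_subtractf)
  \<comment> \<open>The cycle has \<open>Suc q\<close> edges; without the edge from \<open>j\<close>
    to \<open>\<pi> j\<close>, a walk of \<open>q\<close> edges from \<open>\<pi> j\<close> back to
    \<open>j\<close> remains.\<close>
  obtain q where q: "funpow_dist1 \<pi> j j = Suc q" by blast
  have "sum w C = (\<Sum>t<Suc q. w ((\<pi> ^^ t) j))"
    unfolding C_def orbit_conv_funpow_dist1[OF j] q
    using inj_on_funpow_dist1[OF j] unfolding q
    by (simp add: sum.reindex lessThan_atLeast0 del: sum.lessThan_Suc sum.op_ivl_Suc)
  also have "\<dots> = w j + (\<Sum>t<q. w ((\<pi> ^^ t) (\<pi> j)))"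
    by (simp add: sum.lessThan_Suc_shift funpow_swap1 del: sum.lessThan_Suc)
  finally have path: "- w j \<le> (\<Sum>t<q. w ((\<pi> ^^ t) (\<pi> j)))"
    using cycle by simp
  have end_j: "(\<pi> ^^ q) (\<pi> j) = j"
    using funpow_dist1_prop[OF j] unfolding q by (simp add: funpow_swap1)
  \<comment> \<open>The real number \<open>s (\<pi> j)\<close> cancels; only
    \<open>A $ i $ \<rho> j\<close> may be \<open>-\<infinity>\<close>, whence the case
    split.\<close>
  have "definite_form A \<rho> $ i $ j = ?M $ i $ \<pi> j + ereal (- w j)"
    by (cases "A $ i $ \<rho> j") (simp_all add: definite_form_def \<sigma>\<pi> s r w_def)
  also have "\<dots> \<le> ?M $ i $ \<pi> j + ereal (\<Sum>t<q. w ((\<pi> ^^ t) (\<pi> j)))"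
    using path by (intro add_left_mono) simp
  also have "\<dots> \<le> ?M $ i $ \<pi> j + mp_power ?M q $ \<pi> j $ (\<pi> ^^ q) (\<pi> j)"
    by (intro add_left_mono mp_power_funpow_ge) (simp add: w)
  also have "\<dots> \<le> mp_power ?M (Suc q) $ i $ j"
    unfolding end_j by (simp add: mp_mult_ge)
  finally show ?thesis by blast
qed

theorem proposition10:
  fixes A :: "ereal^'n^'n" and \<sigma> \<rho> :: "'n \<Rightarrow> 'n"
  assumes "maxplus_matrix A"
    and "mp_permanent A \<noteq> -\<infinity>"
    and "maximal_permutation A \<sigma>"
    and "maximal_permutation A \<rho>"
  shows "mp_closure (definite_form A \<sigma>) = mp_closure (definite_form A \<rho>)"
  \<comment> \<open>The assumptions are symmetric in \<open>\<sigma>\<close> and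
    \<open>\<rho>\<close>, so the same bound serves both inequalities.\<close>
  by (intro vec_eq_iff[THEN iffD2] allI antisym mp_closure_le
      maxplus_matrix_definite_form definite_form_le_power assms)

end
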